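(* Let $m,n$ be positive integers. Let $T_*$ be a Young tableau with $m$ cells whose length $x$ (number of nonempty columns) and width $y$ (number of nonempty rows) satisfy $x+y\le n$, and suppose $h(T_* )$ is maximal among all Young tableaux with $m$ cells whose length plus width is at most $n$. Then $xy-\min\{x,y\}<m\le xy$.
   Context: A Young tableau is a finite set $T$ of cells $(i,j)\in\mathbb{Z}_{>0}^2$ ($i$ column, $j$ row) such that $(i,j)\in T$, $1\le i'\le i$, $1\le j'\le j$ imply $(i',j')\in T$. Let $x_j=|\{i:(i,j)\in T\}|$, $y_i=|\{j:(i,j)\in T\}|$, and $h(T)=\sum_j f(x_j)+\sum_i f(y_i)$, where $f(z)=z\log z$, $f(0)=0$. (Tableaux correspond to bipartite graphs with a vertex per column and per row, edge $u_iv_j$ iff $(i,j)\in T$, and $h(T)=\sum_v f(\deg v)$.) *)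

theory Defs imports Complex_Main begin

text \<open>A cell \<open>(i, j)\<close> lies in column \<open>i\<close> and row \<open>j\<close>; both indices start at 1.\<close>

definition young_tableau :: "(nat \<times> nat) set \<Rightarrow> bool" where
  "young_tableau T \<longleftrightarrow> finite T \<and> (\<forall>(i, j)\<in>T. 1 \<le> i \<and> 1 \<le> j) \<and>
     (\<forall>i j i' j'. (i, j) \<in> T \<and> 1 \<le> i' \<and> i' \<le> i \<and> 1 \<le> j' \<and> j' \<le> j \<longrightarrow> (i', j') \<in> T)"

definition row_size :: "(nat \<times> nat) set \<Rightarrow> nat \<Rightarrow> nat" where
  "row_size T j = card {i. (i, j) \<in> T}"

definition col_size :: "(nat \<times> nat) set \<Rightarrow> nat \<Rightarrow> nat" where
  "col_size T i = card {j. (i, j) \<in> T}"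

definition tab_length :: "(nat \<times> nat) set \<Rightarrow> nat" where
  "tab_length T = card {i. \<exists>j. (i, j) \<in> T}"

definition tab_width :: "(nat \<times> nat) set \<Rightarrow> nat" where
  "tab_width T = card {j. \<exists>i. (i, j) \<in> T}"

definition zlogz :: "nat \<Rightarrow> real" where
  "zlogz z = (if z = 0 then 0 else real z * ln (real z))"

text \<open>The sums range over the nonempty rows and columns only: all other rows and columns
  contribute \<open>zlogz 0 = 0\<close>, and a sum over an infinite index set would be 0 by convention.\<close>

definition tab_h :: "(nat \<times> nat) set \<Rightarrow> real" where
  "tab_h T = (\<Sum>j\<in>{j. \<exists>i. (i, j) \<in> T}. zlogz (row_size T j)) + (\<Sum>i\<in>{i. \<exists>j. (i, j) \<in> T}. zlogz (col_size T i))"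

end

theory Submission imports Defs begin

text \<open>
  Put \<open>f = zlogz\<close> and \<open>\<phi> k = f k - f (k - 1)\<close>. Summing \<open>\<phi>\<close> along rows and columns shows that \<open>h T\<close>
  is the sum of \<open>\<phi> i + \<phi> j\<close> over the cells \<open>(i, j)\<close> of \<open>T\<close>, so moving cells changes \<open>h\<close> by the
  difference of their weights; \<open>\<phi>\<close> is increasing and strictly concave.

  By symmetry let \<open>y \<le> x\<close>, and suppose \<open>m \<le> (x - 1) y\<close>. Let \<open>a\<close> and \<open>P\<close> be the heights of the last and
  the last but one column, \<open>r\<close> the length of row \<open>P + 1\<close>, and \<open>e = x - 1 - r\<close>, the number of columns
  of height \<open>P\<close>; here \<open>P < y\<close> and \<open>e \<ge> 1\<close>. In each case \<open>h\<close> can be increased: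
  \<^item> if \<open>e \<le> P\<close>, move the top \<open>min e a\<close> cells of the last column to the end of row \<open>P + 1\<close>; concavity
    of \<open>\<phi>\<close> makes each single cell gain;
  \<^item> if \<open>e > P \<ge> r\<close>, remove the top row and lengthen as many of the lowest rows by one cell; this
    respects the bound on length plus width;
  \<^item> if \<open>e > P\<close> and \<open>r > P\<close>, restack all cells beyond column \<open>r\<close> into columns of height \<open>P + 1\<close>. With
    \<open>m'\<close> the number of cells in the first \<open>P + 1\<close> rows, logarithm inequalities show that the new
    shape falls short of \<open>f m'\<close> by at most \<open>2 (P + 1) / 5\<close>, and the old one by more.
\<close>

section \<open>Increments of \<open>z log z\<close>\<close>

text \<open>This is \<open>\<phi>\<close> of the overview. Truncated subtraction makes it
  \<open>0\<close> at \<open>k = 0\<close>, the same value as at \<open>k = 1\<close>, so strict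
  growth starts only at \<open>k = 1\<close>.\<close>

definition zlogz_step :: "nat \<Rightarrow> real" where
  "zlogz_step k = zlogz k - zlogz (k - 1)"

lemma zlogz_eq: "zlogz k = real k * ln (real k)"
  by (simp add: zlogz_def)

lemma zlogz_mult: "zlogz (p * q) = real p * zlogz q + real q * zlogz p"
  by (cases "p = 0 \<or> q = 0") (auto simp: zlogz_eq ln_mult algebra_simps)

lemma sum_zlogz_step:
  assumes "p \<le> q"
  shows "(\<Sum>k\<in>{p<..q}. zlogz_step k) = zlogz q - zlogz p"
  using assms
proof (induction q rule: dec_induct)
  case (step q)
  then have "{p<..Suc q} = insert (Suc q) {p<..q}" by auto
  with step show ?case by (simp add: zlogz_step_def)
qed simp

lemma sum_zlogz_step_from_1: "(\<Sum>k\<in>{1..q}. zlogz_step k) = zlogz q"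
proof -
  have "{1..q} = {0<..q}" by auto
  with sum_zlogz_step[of 0 q] show ?thesis by (simp add: zlogz_eq)
qed

text \<open>With \<open>z = k\<close> the difference of the steps is
  \<open>(z + 1) * ln ((z + 1) / z) - (z - 1) * ln (z / (z - 1))\<close>; the first term is at least
  \<open>1\<close>, the second below \<open>1\<close>.\<close>

lemma zlogz_step_less_Suc:
  assumes "1 \<le> k"
  shows "zlogz_step k < zlogz_step (Suc k)"
proof (cases "k = 1")
  case True
  then show ?thesis by (simp add: zlogz_step_def zlogz_eq)
next
  case False
  define z where "z = real k"
  have z: "z > 1" using assms False by (simp add: z_def)
  have "ln ((z + 1) / z) \<ge> 1 - z / (z + 1)"
    using ln_le_minus_one[of "z / (z + 1)"] z
    by (simp add: ln_div)
  then have 1: "(z + 1) * (ln (z + 1) - ln z) \<ge> 1"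
    using z by (simp add: ln_div field_simps)
  have "ln (z / (z - 1)) < z / (z - 1) - 1"
    using z ln_eq_minus_one[of "z / (z - 1)"] ln_le_minus_one[of "z / (z - 1)"]
    by (fastforce simp: less_le)
  then have 2: "(z - 1) * (ln z - ln (z - 1)) < 1"
    using z by (simp add: ln_div field_simps)
  have "real (k - 1) = z - 1" using assms by (simp add: z_def)
  then have "zlogz_step (Suc k) - zlogz_step k =
      (z + 1) * ln (z + 1) - 2 * z * ln z + (z - 1) * ln (z - 1)"
    by (simp add: zlogz_step_def zlogz_eq z_def algebra_simps)
  also have "\<dots> = (z + 1) * (ln (z + 1) - ln z) - (z - 1) * (ln z - ln (z - 1))"
    by (simp add: algebra_simps)
  finally show ?thesis using 1 2 by linarith
qed

lemma zlogz_step_less: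
  assumes "1 \<le> k" "k < l"
  shows "zlogz_step k < zlogz_step l"
  using assms(2,1)
  by (induction rule: less_Suc_induct) (auto intro: zlogz_step_less_Suc less_trans)

lemma zlogz_step_le:
  assumes "1 \<le> k" "k \<le> l"
  shows "zlogz_step k \<le> zlogz_step l"
  using assms zlogz_step_less[of k l] by (cases "k = l") auto

text \<open>Below, \<open>g\<close> is the second difference of \<open>z * ln z\<close> centred at
  \<open>z\<close>, so the claim is \<open>g (k + 1) < g k\<close>; its derivative
  \<open>ln ((z + 1) * (z - 1)) - ln (z * z)\<close> is negative. For \<open>k = 1\<close> the claim
  reduces to \<open>ln 3 < ln 4\<close>.\<close>

lemma zlogz_step_concave_Suc:
  assumes "1 \<le> k"
  shows "zlogz_step (k + 2) - zlogz_step (k + 1) < zlogz_step (k + 1) - zlogz_step k"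
proof (cases "k = 1")
  case True
  have "ln 3 < ln ((2::real) ^ 2)" by (subst ln_less_cancel_iff) auto
  then have "ln 3 < 2 * ln (2::real)" by (simp only: ln_realpow)
  with True show ?thesis
    using ln_realpow[of "2::real" 2] by (simp add: zlogz_step_def zlogz_eq)
next
  case False
  define g where "g = (\<lambda>z::real. (z + 1) * ln (z + 1) - 2 * (z * ln z) + (z - 1) * ln (z - 1))"
  have k: "real k > 1" "real (k - 1) = real k - 1" using assms False by auto
  have "g (real k + 1) < g (real k)"
  proof (rule DERIV_neg_imp_decreasing[of "real k" "real k + 1" g])
    show "real k < real k + 1" by simp
    fix z :: real assume "real k \<le> z" "z \<le> real k + 1"
    with k have z: "z > 1" by simp
    have "(g has_real_derivative ln (z + 1) - 2 * ln z + ln (z - 1)) (at z)"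
      unfolding g_def using z by (auto intro!: derivative_eq_intros)
    moreover have "ln ((z + 1) * (z - 1)) < ln (z * z)"
    proof -
      have "(z + 1) * (z - 1) > 0" "(z + 1) * (z - 1) < z * z"
        using z by (simp, simp add: algebra_simps)
      then show ?thesis using z by simp
    qed
    ultimately show "\<exists>d. (g has_real_derivative d) (at z) \<and> d < 0"
      using z by (intro exI conjI) (auto simp: ln_mult)
  qed
  then show ?thesis
    using k by (simp add: g_def zlogz_step_def zlogz_eq algebra_simps)
qed

text \<open>Unit slopes strictly decrease, and an increment over length \<open>l\<close> is a sum of
  \<open>l\<close> of them.\<close>

lemma zlogz_step_concave:
  assumes "1 \<le> p" "p \<le> q"
  shows "zlogz_step (q + l) - zlogz_step q \<le> zlogz_step (p + l) - zlogz_step p"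
    and "p < q \<Longrightarrow> 1 \<le> l \<Longrightarrow>
      zlogz_step (q + l) - zlogz_step q < zlogz_step (p + l) - zlogz_step p"
proof -
  have slope: "zlogz_step (q + 1) - zlogz_step q < zlogz_step (p + 1) - zlogz_step p"
    if "1 \<le> p" "p < q" for p q
    using that(2,1)
  proof (induction rule: less_Suc_induct)
    case (1 i)
    then show ?case using zlogz_step_concave_Suc[of i] by simp
  next
    case (2 i j k)
    then show ?case by simp
  qed
  have strict: "p < q \<Longrightarrow> 1 \<le> l \<Longrightarrow>
      zlogz_step (q + l) - zlogz_step q < zlogz_step (p + l) - zlogz_step p" for l
  proof (induction l)
    case (Suc l)
    show ?case
    proof (cases "l = 0")
      case True
      then show ?thesis using slope[of p q] Suc assms by simp
    next
      case False
      then show ?thesis using slope[of "p + l" "q + l"] Suc assms by simp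
    qed
  qed simp
  show "p < q \<Longrightarrow> 1 \<le> l \<Longrightarrow>
      zlogz_step (q + l) - zlogz_step q < zlogz_step (p + l) - zlogz_step p"
    using strict .
  show "zlogz_step (q + l) - zlogz_step q \<le> zlogz_step (p + l) - zlogz_step p"
    using strict[of l] assms by (cases "p = q \<or> l = 0") auto
qed

section \<open>Logarithm bounds for nearly rectangular shapes\<close>

lemma ln_ge_one_minus_inverse:
  fixes z :: real
  assumes "0 < z"
  shows "1 - 1 / z \<le> ln z"
  using ln_le_minus_one[of "1 / z"] assms by (simp add: ln_div)

text \<open>
  A tableau with \<open>M\<close> cells has \<open>h \<le> f M\<close>, with equality for rectangles. The next two lemmas bound
  \<open>h\<close> of a rectangle plus an incomplete column relative to \<open>f M\<close> from both sides; both apply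
  \<open>ln z \<le> z - 1\<close> with weights chosen such that the rational terms add up to at most \<open>0\<close>.
\<close>

lemma zlogz_rectangle_plus_column_le:
  assumes "1 \<le> X" "1 \<le> P" "a \<le> P"
  shows "real X * zlogz P + real P * zlogz X + real a * zlogz_step (Suc X) + zlogz a
    \<le> zlogz (X * P + a)"
proof (cases "a = 0")
  case True
  then show ?thesis by (simp add: zlogz_mult) (simp add: zlogz_eq)
next
  case False
  define u v w where "u = real X" and "v = real P" and "w = real a"
  define M where "M = u * v + w"
  have pos: "u > 0" "v > 0" "w > 0" "w \<le> v" "M > 0"
    using assms False by (auto simp: u_def v_def w_def M_def intro!: add_pos_nonneg)
  \<comment> \<open>Since \<open>zlogz d\<close> adds \<open>ln d\<close> over the \<open>d\<close>
    cells of a line, \<open>h\<close> adds \<open>ln\<close> of row size times column size over all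
    cells. The weights count the cells of the last column, the other cells of its rows, and the
    rest.\<close>
  have 1: "w * ln ((u + 1) * w / M) \<le> w * ((u + 1) * w / M - 1)"
    using pos by (intro mult_left_mono ln_le_minus_one) auto
  have 2: "w * u * ln ((u + 1) * v / M) \<le> w * u * ((u + 1) * v / M - 1)"
    using pos by (intro mult_left_mono ln_le_minus_one) auto
  have 3: "(v - w) * u * ln (u * v / M) \<le> (v - w) * u * (u * v / M - 1)"
    using pos by (intro mult_left_mono ln_le_minus_one) auto
  have "w * ((u + 1) * w / M - 1) + w * u * ((u + 1) * v / M - 1) + (v - w) * u * (u * v / M - 1)
      = (w * w * (u + 1) + w * u * (u + 1) * v + (v - w) * u * (u * v)) / M - M"
    using pos by (simp add: field_simps) (simp add: M_def algebra_simps)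
  also have "\<dots> = w * u * (w - v) / M"
    using pos by (simp add: field_simps) (simp add: M_def algebra_simps)
  also have "\<dots> \<le> 0"
    using pos by (intro divide_nonpos_pos mult_nonneg_nonpos) auto
  finally have "w * ln ((u + 1) * w / M) + w * u * ln ((u + 1) * v / M)
      + (v - w) * u * ln (u * v / M) \<le> 0"
    using 1 2 3 by linarith
  moreover have "w * ln ((u + 1) * w / M) + w * u * ln ((u + 1) * v / M)
      + (v - w) * u * ln (u * v / M)
      = u * (v * ln v) + v * (u * ln u) + w * ((u + 1) * ln (u + 1) - u * ln u) + w * ln w - M * ln M"
    using pos by (simp add: ln_mult ln_div) (simp add: M_def algebra_simps)
  ultimately show ?thesis
    by (simp add: zlogz_eq zlogz_step_def u_def v_def w_def M_def algebra_simps)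
qed

lemma zlogz_rectangle_plus_column_ge:
  assumes "1 \<le> k" "1 \<le> Q" "t \<le> Q"
  shows "zlogz (k * Q + t) - real t * ln (real Q / real t)
    \<le> real k * zlogz Q + real Q * zlogz k + real t * zlogz_step (Suc k) + zlogz t"
proof (cases "t = 0")
  case True
  then show ?thesis by (simp add: zlogz_mult) (simp add: zlogz_eq)
next
  case False
  define u v w where "u = real k" and "v = real Q" and "w = real t"
  define M where "M = u * v + w"
  have pos: "u > 0" "v > 0" "w > 0" "w \<le> v" "M > 0"
    using assms False by (auto simp: u_def v_def w_def M_def intro!: add_pos_nonneg)
  \<comment> \<open>The same count, but with the last column treated as having full height
    \<open>v\<close>, so that its cells join the rest of their rows; \<open>w * ln (v / w)\<close>
    corrects this. The rational terms now cancel exactly.\<close>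
  have 1: "w * (u + 1) * ln (M / ((u + 1) * v)) \<le> w * (u + 1) * (M / ((u + 1) * v) - 1)"
    using pos by (intro mult_left_mono ln_le_minus_one) auto
  have 2: "(v - w) * u * ln (M / (u * v)) \<le> (v - w) * u * (M / (u * v) - 1)"
    using pos by (intro mult_left_mono ln_le_minus_one) auto
  have "w * (u + 1) * (M / ((u + 1) * v) - 1) + (v - w) * u * (M / (u * v) - 1) = 0"
    using pos by (simp add: divide_simps) (simp add: M_def algebra_simps)
  then have "w * (u + 1) * ln (M / ((u + 1) * v)) + (v - w) * u * ln (M / (u * v)) \<le> 0"
    using 1 2 by linarith
  moreover have "w * (u + 1) * ln (M / ((u + 1) * v)) + (v - w) * u * ln (M / (u * v))
     = M * ln M - w * ln (v / w)
       - (u * (v * ln v) + v * (u * ln u) + w * ((u + 1) * ln (u + 1) - u * ln u) + w * ln w)"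
    using pos by (simp add: ln_mult ln_div) (simp add: M_def algebra_simps)
  ultimately show ?thesis
    by (simp add: zlogz_eq zlogz_step_def u_def v_def w_def M_def algebra_simps)
qed

text \<open>Splitting the cell counts as \<open>u + u * v + w\<close> and \<open>u * v + w\<close>
  turns the right side into three weighted logarithms; bounding each by
  \<open>ln z \<ge> 1 - 1 / z\<close> leaves exactly \<open>u * w / M\<close>.\<close>

lemma zlogz_second_difference_ge:
  assumes "1 \<le> r" "1 \<le> P"
  shows "real r * real R / real (r * Suc P + R)
    \<le> zlogz (r * Suc P + R) - zlogz (r * P + R) - zlogz (r * Suc P) + zlogz (r * P)"
proof -
  define u v w where "u = real r" and "v = real P" and "w = real R"
  define M where "M = u * (v + 1) + w"
  have "u > 0" "v > 0" "w \<ge> 0"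
    using assms by (auto simp: u_def v_def w_def)
  moreover from this have "M - u > 0"
    by (simp add: M_def algebra_simps add_nonneg_pos)
  ultimately have pos: "u > 0" "v > 0" "w \<ge> 0" "M - u > 0" "M > 0"
    by auto
  have 1: "u * (1 - 1 / (M / (u * (v + 1)))) \<le> u * ln (M / (u * (v + 1)))"
    using pos by (intro mult_left_mono ln_ge_one_minus_inverse) auto
  have 2: "u * v * (1 - 1 / (M * v / ((v + 1) * (M - u)))) \<le> u * v * ln (M * v / ((v + 1) * (M - u)))"
    using pos by (intro mult_left_mono ln_ge_one_minus_inverse) auto
  have 3: "w * (1 - 1 / (M / (M - u))) \<le> w * ln (M / (M - u))"
    using pos by (intro mult_left_mono ln_ge_one_minus_inverse) auto
  have "u * (1 - 1 / (M / (u * (v + 1)))) + u * v * (1 - 1 / (M * v / ((v + 1) * (M - u))))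
      + w * (1 - 1 / (M / (M - u))) = u * w / M"
    using pos by (simp add: divide_simps) (simp add: M_def algebra_simps)
  moreover have "u * ln (M / (u * (v + 1))) + u * v * ln (M * v / ((v + 1) * (M - u)))
      + w * ln (M / (M - u))
      = M * ln M - (M - u) * ln (M - u) - u * (v + 1) * ln (u * (v + 1)) + u * v * ln (u * v)"
    using pos by (simp add: ln_mult ln_div) (simp add: M_def algebra_simps)
  ultimately have "u * w / M
      \<le> M * ln M - (M - u) * ln (M - u) - u * (v + 1) * ln (u * (v + 1)) + u * v * ln (u * v)"
    using 1 2 3 by linarith
  moreover have eqs: "real (r * Suc P + R) = M" "real (r * P + R) = M - u"
      "real (r * Suc P) = u * (v + 1)" "real (r * P) = u * v"
    by (simp_all add: u_def v_def w_def M_def algebra_simps)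
  ultimately show ?thesis
    by (simp only: zlogz_eq eqs flip: u_def w_def)
qed

text \<open>The maximum over \<open>t\<close> is \<open>q / exp 1\<close>, and
  \<open>exp 1 \<ge> 5 / 2\<close>.\<close>

lemma mult_ln_div_le:
  fixes t q :: real
  assumes "0 \<le> t" "0 < q"
  shows "t * ln (q / t) \<le> 2 / 5 * q"
proof (cases "t = 0")
  case False
  then have t: "t > 0" using assms by simp
  have e: "exp 1 \<ge> (5 / 2 :: real)"
    using exp_lower_Taylor_quadratic[of 1] by simp
  have "ln (q / t / exp 1) \<le> q / t / exp 1 - 1"
    using t assms by (intro ln_le_minus_one) auto
  then have "ln (q / t) \<le> q / t / exp 1"
    using t assms by (simp add: ln_div ln_mult)
  also have "\<dots> \<le> q / t / (5 / 2)"
    using e t assms by (intro divide_left_mono) auto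
  finally show ?thesis using t by (simp add: field_simps)
qed (use assms in simp)

text \<open>The two sides are the weights of the cells beyond column \<open>r\<close> before and
  after restacking. \<open>A\<close> bounds the first \<open>P\<close> rows of the old shape from
  above, \<open>B\<close> the first \<open>Q\<close> rows of the new one from below; the mixed
  difference in \<open>C\<close> must then beat the loss in \<open>D\<close>.\<close>

lemma restack_gain:
  assumes Q: "Q = Suc P" "1 \<le> P" and "Q \<le> r" "Q \<le> e" "1 \<le> a" "a \<le> P" "t < Q"
    and M: "k * Q + t = r * Q + e * P + a"
  shows "real P * (zlogz (r + e) - zlogz r) + real e * zlogz P
      + real a * zlogz_step (Suc (r + e)) + zlogz a
    < real Q * (zlogz k - zlogz r) + (real k - real r) * zlogz Q
      + real t * zlogz_step (Suc k) + zlogz t"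
proof -
  define R where "R = e * P + a"
  have k: "1 \<le> k"
    using assms by (cases k) auto
  have A: "real (r + e) * zlogz P + real P * zlogz (r + e) + real a * zlogz_step (Suc (r + e))
      + zlogz a \<le> zlogz (r * P + R)"
    using zlogz_rectangle_plus_column_le[of "r + e" P a] assms by (simp add: R_def algebra_simps)
  have B: "zlogz (r * Q + R) - real t * ln (real Q / real t)
    \<le> real k * zlogz Q + real Q * zlogz k + real t * zlogz_step (Suc k) + zlogz t"
    using zlogz_rectangle_plus_column_ge[of k Q t] assms k by (simp add: R_def algebra_simps)
  have C: "real r * real R / real (r * Q + R)
    \<le> zlogz (r * Q + R) - zlogz (r * P + R) - zlogz (r * Q) + zlogz (r * P)"
    using zlogz_second_difference_ge[of r P R] assms by simp
  have D: "real t * ln (real Q / real t) \<le> 2 / 5 * real Q"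
    using Q by (intro mult_ln_div_le) auto
  \<comment> \<open>\<open>Q \<le> e\<close> makes \<open>R\<close> so large that
    \<open>2 * Q * Q < 3 * R\<close>, because \<open>Q * Q - 3 * Q + 3 > 0\<close>.\<close>
  have "Q * P + 1 \<le> R"
    unfolding R_def using assms by (intro add_mono mult_mono) auto
  then have "real Q * real P + 1 \<le> real R"
    by (metis of_nat_1 of_nat_add of_nat_le_iff of_nat_mult)
  moreover have "real P = real Q - 1" using Q by simp
  ultimately have "real Q * (real Q - 1) + 1 \<le> real R" by simp
  moreover have "2 * (real Q * real Q) < 3 * (real Q * (real Q - 1) + 1)"
    using zero_le_square[of "real Q - 3 / 2"] by (simp add: algebra_simps)
  ultimately have R: "2 * (real Q * real Q) < 3 * real R" by (simp add: algebra_simps)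
  have r: "real Q \<le> real r" "real Q > 0" using assms by auto
  \<comment> \<open>Of the five copies of \<open>r * R\<close>, three absorb
    \<open>2 * r * Q * Q\<close> and two absorb \<open>2 * Q * R\<close>, by
    \<open>Q \<le> r\<close>.\<close>
  have "2 * real Q * (real r * real Q + real R) < 5 * (real r * real R)"
  proof -
    have "real r * (2 * (real Q * real Q)) < real r * (3 * real R)"
      using R r by (intro mult_strict_left_mono) auto
    moreover have "real Q * real R \<le> real r * real R"
      using r by (intro mult_right_mono) auto
    ultimately show ?thesis by (simp add: algebra_simps)
  qed
  moreover have "real (r * Q + R) > 0" using r by (auto intro: add_pos_nonneg)
  ultimately have "2 / 5 * real Q < real r * real R / real (r * Q + R)"
    by (simp add: pos_less_divide_eq algebra_simps)
  with C D have "real t * ln (real Q / real t)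
    < zlogz (r * Q + R) - zlogz (r * P + R) - zlogz (r * Q) + zlogz (r * P)"
    by linarith
  then show ?thesis
    using A B zlogz_mult[of r Q] zlogz_mult[of r P] by (simp add: algebra_simps)
qed

section \<open>Cell weights and exchanges of cells\<close>

lemma initial_segment_eq:
  fixes A :: "nat set"
  assumes "finite A" and "\<And>i i'. i \<in> A \<Longrightarrow> 1 \<le> i' \<Longrightarrow> i' \<le> i \<Longrightarrow> i' \<in> A" and "0 \<notin> A"
  shows "A = {1..card A}"
proof (cases "A = {}")
  case False
  have "A = {1..Max A}"
  proof (intro equalityI subsetI)
    fix i assume "i \<in> A"
    then show "i \<in> {1..Max A}"
      using assms(1,3) by (cases "i = 0") auto
  next
    fix i assume "i \<in> {1..Max A}"
    then show "i \<in> A"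
      using assms(2)[of "Max A" i] Max_in[OF assms(1) False] by simp
  qed
  moreover from this have "card A = Max A" by (metis card_atLeastAtMost diff_Suc_1)
  ultimately show ?thesis by simp
qed simp

lemma young_tableauI:
  assumes "finite T" and "\<And>i j. (i, j) \<in> T \<Longrightarrow> 1 \<le> i \<and> 1 \<le> j"
    and "\<And>i j i' j'. (i, j) \<in> T \<Longrightarrow> 1 \<le> i' \<Longrightarrow> i' \<le> i \<Longrightarrow> 1 \<le> j' \<Longrightarrow> j' \<le> j \<Longrightarrow> (i', j') \<in> T"
  shows "young_tableau T"
  using assms unfolding young_tableau_def by blast

lemma mem_swap_image: "(i, j) \<in> prod.swap ` T \<longleftrightarrow> (j, i) \<in> T"
  by (force simp: image_iff)

context
  fixes T assumes T: "young_tableau T"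
begin

lemma young_finite: "finite T"
  using T by (simp add: young_tableau_def)

lemma young_pos: "(i, j) \<in> T \<Longrightarrow> 1 \<le> i \<and> 1 \<le> j"
  using T by (auto simp: young_tableau_def)

lemma young_down:
  "(i, j) \<in> T \<Longrightarrow> 1 \<le> i' \<Longrightarrow> i' \<le> i \<Longrightarrow> 1 \<le> j' \<Longrightarrow> j' \<le> j \<Longrightarrow> (i', j') \<in> T"
  using T unfolding young_tableau_def by blast

lemma young_row: "{i. (i, j) \<in> T} = {1..row_size T j}"
  unfolding row_size_def
proof (rule initial_segment_eq)
  have "{i. (i, j) \<in> T} \<subseteq> fst ` T" by force
  then show "finite {i. (i, j) \<in> T}"
    using young_finite finite_subset by blast
  show "i' \<in> {i. (i, j) \<in> T}" if "i \<in> {i. (i, j) \<in> T}" "1 \<le> i'" "i' \<le> i" for i i'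
    using that young_down[of i j i' j] young_pos[of i j] by simp
  show "0 \<notin> {i. (i, j) \<in> T}" using young_pos[of 0 j] by auto
qed

lemma young_col: "{j. (i, j) \<in> T} = {1..col_size T i}"
  unfolding col_size_def
proof (rule initial_segment_eq)
  have "{j. (i, j) \<in> T} \<subseteq> snd ` T" by force
  then show "finite {j. (i, j) \<in> T}"
    using young_finite finite_subset by blast
  show "j' \<in> {j. (i, j) \<in> T}" if "j \<in> {j. (i, j) \<in> T}" "1 \<le> j'" "j' \<le> j" for j j'
    using that young_down[of i j i j'] young_pos[of i j] by simp
  show "0 \<notin> {j. (i, j) \<in> T}" using young_pos[of i 0] by auto
qed

lemma mem_iff_row: "(i, j) \<in> T \<longleftrightarrow> 1 \<le> i \<and> i \<le> row_size T j"
  using young_row[of j] by (simp add: set_eq_iff)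

lemma mem_iff_col: "(i, j) \<in> T \<longleftrightarrow> 1 \<le> j \<and> j \<le> col_size T i"
  using young_col[of i] by (simp add: set_eq_iff)

lemma first_row_iff: "(i, 1) \<in> T \<longleftrightarrow> (\<exists>j. (i, j) \<in> T)"
proof
  assume "\<exists>j. (i, j) \<in> T"
  then obtain j where "(i, j) \<in> T" ..
  then show "(i, 1) \<in> T" using young_down[of i j i 1] young_pos[of i j] by simp
qed blast

lemma first_column_iff: "(1, j) \<in> T \<longleftrightarrow> (\<exists>i. (i, j) \<in> T)"
proof
  assume "\<exists>i. (i, j) \<in> T"
  then obtain i where "(i, j) \<in> T" ..
  then show "(1, j) \<in> T" using young_down[of i j 1 j] young_pos[of i j] by simp
qed blast

lemma young_columns: "{i. \<exists>j. (i, j) \<in> T} = {1..tab_length T}"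
  using young_row[of 1] by (simp only: tab_length_def first_row_iff) (metis card_atLeastAtMost diff_Suc_1)

lemma young_rows: "{j. \<exists>i. (i, j) \<in> T} = {1..tab_width T}"
  using young_col[of 1] by (simp only: tab_width_def first_column_iff) (metis card_atLeastAtMost diff_Suc_1)

lemma young_subset_box: "T \<subseteq> {1..tab_length T} \<times> {1..tab_width T}"
proof (rule subrelI)
  fix i j assume "(i, j) \<in> T"
  then have "i \<in> {i. \<exists>j. (i, j) \<in> T}" "j \<in> {j. \<exists>i. (i, j) \<in> T}" by auto
  then show "(i, j) \<in> {1..tab_length T} \<times> {1..tab_width T}"
    unfolding young_columns young_rows by simp
qed

text \<open>Rows and columns are initial segments, so the steps along each telescope to
  \<open>zlogz\<close> of its size; row sums supply \<open>zlogz_step i\<close>, column sums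
  \<open>zlogz_step j\<close>.\<close>

lemma tab_h_eq_sum_steps: "tab_h T = (\<Sum>(i, j)\<in>T. zlogz_step i + zlogz_step j)"
proof -
  have "(\<Sum>j\<in>{1..tab_width T}. zlogz (row_size T j))
      = (\<Sum>j\<in>{1..tab_width T}. \<Sum>i\<in>{i. (i, j) \<in> T}. zlogz_step i)"
    by (simp only: young_row sum_zlogz_step_from_1)
  also have "\<dots> = (\<Sum>(j, i)\<in>(SIGMA j:{1..tab_width T}. {i. (i, j) \<in> T}). zlogz_step i)"
    by (intro sum.Sigma) (auto simp: young_row)
  also have "\<dots> = (\<Sum>(i, j)\<in>T. zlogz_step i)"
    using young_subset_box
    by (intro sum.reindex_bij_witness[of _ prod.swap prod.swap]) auto
  finally have rows: "(\<Sum>j\<in>{1..tab_width T}. zlogz (row_size T j)) = (\<Sum>(i, j)\<in>T. zlogz_step i)" .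
  have "(\<Sum>i\<in>{1..tab_length T}. zlogz (col_size T i))
      = (\<Sum>i\<in>{1..tab_length T}. \<Sum>j\<in>{j. (i, j) \<in> T}. zlogz_step j)"
    by (simp only: young_col sum_zlogz_step_from_1)
  also have "\<dots> = (\<Sum>(i, j)\<in>(SIGMA i:{1..tab_length T}. {j. (i, j) \<in> T}). zlogz_step j)"
    by (intro sum.Sigma) (auto simp: young_col)
  also have "(SIGMA i:{1..tab_length T}. {j. (i, j) \<in> T}) = T"
    using young_subset_box by auto
  finally show ?thesis
    unfolding tab_h_def young_rows young_columns
    using rows by (simp add: case_prod_unfold sum.distrib)
qed

lemma young_swap: "young_tableau (prod.swap ` T)"
proof (rule young_tableauI)
  show "finite (prod.swap ` T)" by (simp add: young_finite)
  show "1 \<le> i \<and> 1 \<le> j" if "(i, j) \<in> prod.swap ` T" for i j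
    using that young_pos[of j i] by (auto simp: mem_swap_image)
  show "(i', j') \<in> prod.swap ` T"
    if "(i, j) \<in> prod.swap ` T" "1 \<le> i'" "i' \<le> i" "1 \<le> j'" "j' \<le> j" for i j i' j'
    using that young_down[of j i j' i'] by (simp add: mem_swap_image)
qed

end

section \<open>Transposition and exchange of cells\<close>

lemma tab_length_le: "S \<subseteq> {1..X} \<times> {1..Y} \<Longrightarrow> tab_length S \<le> X"
  using card_mono[of "{1..X}" "{i. \<exists>j. (i, j) \<in> S}"] by (auto simp: tab_length_def)

lemma tab_width_le: "S \<subseteq> {1..X} \<times> {1..Y} \<Longrightarrow> tab_width S \<le> Y"
  using card_mono[of "{1..Y}" "{j. \<exists>i. (i, j) \<in> S}"] by (auto simp: tab_width_def)

lemma tab_swap: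
  "tab_length (prod.swap ` T) = tab_width T" "tab_width (prod.swap ` T) = tab_length T"
  "tab_h (prod.swap ` T) = tab_h T" "card (prod.swap ` T) = card T"
  by (simp_all add: tab_length_def tab_width_def tab_h_def row_size_def col_size_def
      mem_swap_image card_image)

text \<open>Bounding by the length plus width of \<open>T\<close> itself instead of \<open>n\<close>
  keeps the notion free of parameters and invariant under transposition.\<close>

definition improvable :: "(nat \<times> nat) set \<Rightarrow> bool" where
  "improvable T \<longleftrightarrow> (\<exists>S. young_tableau S \<and> card S = card T \<and>
     tab_length S + tab_width S \<le> tab_length T + tab_width T \<and> tab_h T < tab_h S)"

lemma improvable_swap:
  assumes "improvable (prod.swap ` T)"
  shows "improvable T"
  using assms unfolding improvable_def by (auto simp: tab_swap)

lemma exchange_improves: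
  assumes T: "young_tableau T" and "A \<subseteq> T" "B \<inter> (T - A) = {}" "finite B" "card A = card B"
    and S: "young_tableau (T - A \<union> B)" "T - A \<union> B \<subseteq> {1..X} \<times> {1..Y}"
    and "X + Y \<le> tab_length T + tab_width T"
    and "(\<Sum>(i, j)\<in>A. zlogz_step i + zlogz_step j) < (\<Sum>(i, j)\<in>B. zlogz_step i + zlogz_step j)"
  shows "improvable T"
  unfolding improvable_def
proof (intro exI conjI)
  have fin: "finite T" "finite A" using young_finite[OF T] assms(2) finite_subset by auto
  show "card (T - A \<union> B) = card T"
    using fin assms(2-5) card_mono[of T A] by (subst card_Un_disjoint) (auto simp: card_Diff_subset)
  show "tab_length (T - A \<union> B) + tab_width (T - A \<union> B) \<le> tab_length T + tab_width T"
    using tab_length_le[OF S(2)] tab_width_le[OF S(2)] assms(8) by simp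
  let ?w = "\<lambda>(i, j). zlogz_step i + zlogz_step j"
  have "sum ?w (T - A \<union> B) = sum ?w (T - A) + sum ?w B"
    using fin assms(3,4) by (intro sum.union_disjoint) auto
  also have "sum ?w (T - A) = sum ?w T - sum ?w A"
    using fin assms(2) by (intro sum_diff) auto
  finally show "tab_h T < tab_h (T - A \<union> B)"
    using assms(9) by (simp add: tab_h_eq_sum_steps[OF T] tab_h_eq_sum_steps[OF S(1)])
qed (rule S)

lemma sum_steps_rectangle:
  "(\<Sum>(i, j)\<in>I \<times> J. zlogz_step i + zlogz_step j)
    = real (card J) * (\<Sum>i\<in>I. zlogz_step i) + real (card I) * (\<Sum>j\<in>J. zlogz_step j)"
  by (simp add: sum.cartesian_product[symmetric] sum.distrib sum_distrib_left)

section \<open>Improving tableaux with many missing cells\<close>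

text \<open>
  The part of \<open>T\<close> beyond column \<open>r\<close> consists of \<open>e\<close> columns of height \<open>P\<close> and a last column of height
  \<open>a \<le> P\<close>, while the columns up to \<open>r\<close> have height at least \<open>P + 1\<close>.
\<close>

locale step_tail =
  fixes T :: "(nat \<times> nat) set" and r e a P :: nat
  assumes T: "young_tableau T"
    and pos: "1 \<le> r" "1 \<le> e" "1 \<le> a" "a \<le> P"
    and block: "\<And>i j. 1 \<le> i \<Longrightarrow> i \<le> r \<Longrightarrow> 1 \<le> j \<Longrightarrow> j \<le> Suc P \<Longrightarrow> (i, j) \<in> T"
    and tail: "\<And>i j. r < i \<Longrightarrow> (i, j) \<in> T \<longleftrightarrow>
      i \<le> r + e \<and> 1 \<le> j \<and> j \<le> P \<or> i = Suc (r + e) \<and> 1 \<le> j \<and> j \<le> a"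
begin

lemma length_eq: "tab_length T = Suc (r + e)"
proof -
  have "(i, 1) \<in> T \<longleftrightarrow> 1 \<le> i \<and> i \<le> Suc (r + e)" for i
  proof (cases "r < i")
    case True
    then show ?thesis using tail[of i 1] pos by auto
  next
    case False
    then have "1 \<le> i \<Longrightarrow> (i, 1) \<in> T" using block[of i 1] by auto
    with False show ?thesis using young_pos[OF T, of i 1] by auto
  qed
  then have "{i. (i, 1) \<in> T} = {1..Suc (r + e)}" unfolding set_eq_iff by simp
  then show ?thesis by (simp only: tab_length_def first_row_iff[OF T]) simp
qed

lemma width_ge: "Suc P \<le> tab_width T"
proof -
  have "(1, Suc P) \<in> T" using block[of 1] pos by auto
  then show ?thesis using young_subset_box[OF T] by auto
qed

lemma mem_box: "(i, j) \<in> T \<Longrightarrow> 1 \<le> i \<and> i \<le> Suc (r + e) \<and> 1 \<le> j \<and> j \<le> tab_width T"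
  using young_subset_box[OF T] length_eq by auto

lemma low_mem: "1 \<le> i \<Longrightarrow> i \<le> r + e \<Longrightarrow> 1 \<le> j \<Longrightarrow> j \<le> P \<Longrightarrow> (i, j) \<in> T"
  using block[of i j] tail[of i j] by (cases "r < i") auto

lemma last_mem: "1 \<le> i \<Longrightarrow> i \<le> Suc (r + e) \<Longrightarrow> 1 \<le> j \<Longrightarrow> j \<le> a \<Longrightarrow> (i, j) \<in> T"
  using low_mem[of i j] tail[of i j] pos by (cases "i \<le> r + e") auto

text \<open>The last hypothesis secures a strict gain: if \<open>P < r + e\<close>, concavity is
  strict; if \<open>P = r + e\<close>, then \<open>a \<le> e\<close>, and the moved cells lie low
  enough for strict monotonicity.\<close>

lemma improvable_short_tail:
  assumes "e \<le> P" "P \<le> r + e" "P < r + e \<or> a \<le> e"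
  shows "improvable T"
proof -
  define s where "s = min e a"
  have s: "1 \<le> s" "s \<le> e" "s \<le> a" "s = e \<or> s = a" using pos by (auto simp: s_def)
  define A where "A = {Suc (r + e)} \<times> {a - s<..a}"
  define B where "B = {r<..r + s} \<times> {Suc P}"
  have memS: "(i, j) \<in> T - A \<union> B \<longleftrightarrow>
      (i, j) \<in> T \<and> (i \<le> r + e \<or> j \<le> a - s) \<or> r < i \<and> i \<le> r + s \<and> j = Suc P" for i j
    using mem_box[of i j] tail[of i j] unfolding A_def B_def by auto
  show ?thesis
  proof (rule exchange_improves[OF T])
    show "A \<subseteq> T" using last_mem unfolding A_def by auto
    show "B \<inter> (T - A) = {}" using s tail by (auto simp: B_def)
    show "card A = card B" "finite B" using s by (simp_all add: A_def B_def card_cartesian_product)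
    show "T - A \<union> B \<subseteq> {1..Suc (r + e)} \<times> {1..tab_width T}"
      using young_subset_box[OF T] length_eq width_ge s by (auto simp: B_def)
    show "Suc (r + e) + tab_width T \<le> tab_length T + tab_width T"
      by (simp add: length_eq)
    show "young_tableau (T - A \<union> B)"
    proof (rule young_tableauI)
      show "finite (T - A \<union> B)" using young_finite[OF T] by (simp add: B_def)
      show "1 \<le> i \<and> 1 \<le> j" if "(i, j) \<in> T - A \<union> B" for i j
        using that young_pos[OF T, of i j] unfolding memS by auto
      show "(i', j') \<in> T - A \<union> B"
        if "(i, j) \<in> T - A \<union> B" "1 \<le> i'" "i' \<le> i" "1 \<le> j'" "j' \<le> j" for i j i' j'
      proof (cases "(i, j) \<in> T")
        case True
        then show ?thesis
          using that s young_down[OF T True, of i' j'] unfolding memS by auto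
      next
        case False
        then show ?thesis
          using that s low_mem[of i' j'] block[of i' j'] unfolding memS
          by (cases "i' \<le> r"; cases "j' \<le> P") auto
      qed
    qed
    have gain: "zlogz_step (Suc (r + e)) + zlogz_step (a - s + k) < zlogz_step (r + k) + zlogz_step (Suc P)"
      if "k \<in> {1..s}" for k
    proof -
      \<comment> \<open>Cell \<open>(Suc (r + e), a - s + k)\<close> goes to
        \<open>(r + k, Suc P)\<close>. Raising its row index to \<open>P - e + k\<close> makes both
        index changes a shift by \<open>Suc e - k\<close>, and concavity applies as
        \<open>P - e \<le> r\<close>.\<close>
      have eqs: "P - e + k + (Suc e - k) = Suc P" "r + k + (Suc e - k) = Suc (r + e)"
        using that s assms by auto
      have le: "zlogz_step (a - s + k) \<le> zlogz_step (P - e + k)"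
        using that s pos assms by (intro zlogz_step_le) auto
      have conc: "zlogz_step (Suc (r + e)) - zlogz_step (r + k) \<le> zlogz_step (Suc P) - zlogz_step (P - e + k)"
        by (rule zlogz_step_concave(1)[of "P - e + k" "r + k" "Suc e - k", unfolded eqs])
          (use that s assms in auto)
      show ?thesis
      proof (cases "P - e < r")
        case True
        then have "zlogz_step (Suc (r + e)) - zlogz_step (r + k) < zlogz_step (Suc P) - zlogz_step (P - e + k)"
          by (intro zlogz_step_concave(2)[of "P - e + k" "r + k" "Suc e - k", unfolded eqs])
            (use that s assms in auto)
        with le show ?thesis by linarith
      next
        case False
        then have "zlogz_step (a - s + k) < zlogz_step (P - e + k)"
          using that s pos assms by (intro zlogz_step_less) auto
        with conc show ?thesis by linarith
      qed
    qed
    have "(\<Sum>(i, j)\<in>A. zlogz_step i + zlogz_step j)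
        = (\<Sum>k\<in>{1..s}. zlogz_step (Suc (r + e)) + zlogz_step (a - s + k))"
      unfolding A_def using s
      by (intro sum.reindex_bij_witness[of _ "\<lambda>k. (Suc (r + e), a - s + k)" "\<lambda>p. snd p - (a - s)"]) auto
    also have "\<dots> < (\<Sum>k\<in>{1..s}. zlogz_step (r + k) + zlogz_step (Suc P))"
      using gain s by (intro sum_strict_mono) auto
    also have "\<dots> = (\<Sum>(i, j)\<in>B. zlogz_step i + zlogz_step j)"
      unfolding B_def
      by (intro sum.reindex_bij_witness[of _ "\<lambda>p. fst p - r" "\<lambda>k. (r + k, Suc P)"]) auto
    finally show "(\<Sum>(i, j)\<in>A. zlogz_step i + zlogz_step j) < (\<Sum>(i, j)\<in>B. zlogz_step i + zlogz_step j)" .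
  qed
qed

lemma improvable_by_restacking:
  assumes "Suc P \<le> r" "Suc P \<le> e"
  shows "improvable T"
proof -
  define Q where "Q = Suc P"
  \<comment> \<open>The block of \<open>r\<close> columns of height \<open>Q\<close> is counted too,
    so \<open>k\<close> is the index of the last full column and \<open>t\<close> the height of the
    next one.\<close>
  define k t where "k = (r * Q + e * P + a) div Q" and "t = (r * Q + e * P + a) mod Q"
  have kt: "k * Q + t = r * Q + e * P + a" "t < Q"
    unfolding k_def t_def by (simp_all only: div_mult_mod_eq) (simp add: Q_def)
  have "r * Q \<le> k * Q + t" using kt by simp
  then have "r * Q < Suc k * Q" using kt(2) by simp
  then have rk: "r \<le> k" by (simp only: mult_less_cancel2 less_Suc_eq_le)
  \<comment> \<open>This keeps the partial column \<open>Suc k\<close> within the old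
    length.\<close>
  have "k * Q + t < Suc (r + e) * Q" using kt pos assms unfolding kt(1) by (simp add: Q_def algebra_simps)
  then have "k * Q < Suc (r + e) * Q" by linarith
  then have kre: "k < Suc (r + e)" by (metis mult_less_cancel2)
  define A where "A = {r<..r + e} \<times> {1..P} \<union> {Suc (r + e)} \<times> {1..a}"
  define B where "B = {r<..k} \<times> {1..Q} \<union> {Suc k} \<times> {1..t}"
  have TA: "(i, j) \<in> T - A \<longleftrightarrow> (i, j) \<in> T \<and> i \<le> r" for i j
    using tail[of i j] unfolding A_def by (cases "r < i") auto
  have memS: "(i, j) \<in> T - A \<union> B \<longleftrightarrow>
      (i, j) \<in> T \<and> i \<le> r \<or> 1 \<le> j \<and> (r < i \<and> i \<le> k \<and> j \<le> Q \<or> i = Suc k \<and> j \<le> t)" for i j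
    unfolding Un_iff TA B_def by auto
  have A_disj: "{r<..r + e} \<times> {1..P} \<inter> {Suc (r + e)} \<times> {1..a} = {}"
    and B_disj: "{r<..k} \<times> {1..Q} \<inter> {Suc k} \<times> {1..t} = {}" by auto
  show ?thesis
  proof (rule exchange_improves[OF T])
    show "A \<subseteq> T" by (auto simp: A_def tail)
    show "B \<inter> (T - A) = {}"
    proof (intro equals0I)
      fix p assume "p \<in> B \<inter> (T - A)"
      then obtain i j where "(i, j) \<in> B" "(i, j) \<in> T - A" by (cases p) auto
      then show False using TA[of i j] rk by (auto simp: B_def)
    qed
    show "finite B" by (simp add: B_def)
    have "card A = e * P + a"
      unfolding A_def by (subst card_Un_disjoint[OF _ _ A_disj]) (auto simp: card_cartesian_product)
    moreover have "card B = (k - r) * Q + t"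
      unfolding B_def by (subst card_Un_disjoint[OF _ _ B_disj]) (auto simp: card_cartesian_product)
    moreover have "k * Q = r * Q + (k - r) * Q" using rk by (simp flip: add_mult_distrib)
    ultimately show "card A = card B" using kt by linarith
    show "T - A \<union> B \<subseteq> {1..Suc (r + e)} \<times> {1..tab_width T}"
      using young_subset_box[OF T] length_eq width_ge kre kt(2) by (auto simp: B_def Q_def)
    show "Suc (r + e) + tab_width T \<le> tab_length T + tab_width T"
      by (simp add: length_eq)
    show "young_tableau (T - A \<union> B)"
    proof (rule young_tableauI)
      show "finite (T - A \<union> B)" using young_finite[OF T] by (simp add: B_def)
      show "1 \<le> i \<and> 1 \<le> j" if "(i, j) \<in> T - A \<union> B" for i j
        using that young_pos[OF T, of i j] unfolding memS by auto
      show "(i', j') \<in> T - A \<union> B"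
        if "(i, j) \<in> T - A \<union> B" "1 \<le> i'" "i' \<le> i" "1 \<le> j'" "j' \<le> j" for i j i' j'
      proof (cases "(i, j) \<in> T \<and> i \<le> r")
        case True
        then show ?thesis
          using that young_down[OF T, of i j i' j'] unfolding memS by auto
      next
        case False
        then have "j' \<le> Q" "i' \<le> k \<or> i' = Suc k \<and> i = Suc k \<and> j \<le> t"
          using that kt(2) unfolding memS by auto
        then show ?thesis
          using that block[of i' j'] unfolding memS by (cases "i' \<le> r") (auto simp: Q_def)
      qed
    qed
    have "(\<Sum>(i, j)\<in>A. zlogz_step i + zlogz_step j)
        = real P * (zlogz (r + e) - zlogz r) + real e * zlogz P
          + real a * zlogz_step (Suc (r + e)) + zlogz a"
      unfolding A_def
      by (subst sum.union_disjoint[OF _ _ A_disj])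
        (simp_all only: sum_steps_rectangle sum_zlogz_step_from_1 sum_zlogz_step[OF le_add1], simp_all)
    moreover have "(\<Sum>(i, j)\<in>B. zlogz_step i + zlogz_step j)
        = real Q * (zlogz k - zlogz r) + (real k - real r) * zlogz Q
          + real t * zlogz_step (Suc k) + zlogz t"
      unfolding B_def using rk
      by (subst sum.union_disjoint[OF _ _ B_disj])
        (simp_all only: sum_steps_rectangle sum_zlogz_step_from_1 sum_zlogz_step[OF rk], simp_all add: of_nat_diff)
    moreover have "real P * (zlogz (r + e) - zlogz r) + real e * zlogz P
        + real a * zlogz_step (Suc (r + e)) + zlogz a
      < real Q * (zlogz k - zlogz r) + (real k - real r) * zlogz Q
        + real t * zlogz_step (Suc k) + zlogz t"
      using restack_gain[of Q P r e a t k] assms pos kt by (simp add: Q_def)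
    ultimately show "(\<Sum>(i, j)\<in>A. zlogz_step i + zlogz_step j)
        < (\<Sum>(i, j)\<in>B. zlogz_step i + zlogz_step j)" by linarith
  qed
qed

text \<open>Pair the removed cell in column \<open>i\<close> with the new cell in row
  \<open>i\<close>: both weights contain \<open>zlogz_step i\<close>, while the row index
  \<open>y\<close> is replaced by a column index at least \<open>y\<close>, strictly larger in row
  \<open>1\<close>. The length grows by at most one and the width drops.\<close>

lemma improvable_by_last_row:
  assumes "r \<le> P" "tab_width T \<le> Suc (r + e)"
  shows "improvable T"
proof -
  define y where "y = tab_width T"
  define b where "b = row_size T y"
  have y: "P < y" using width_ge by (simp add: y_def)
  have "y \<in> {j. \<exists>i. (i, j) \<in> T}" using young_rows[OF T] y by (simp add: y_def)
  then obtain i where "(i, y) \<in> T" by blast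
  then have b1: "1 \<le> b" using mem_iff_row[OF T, of i y] by (simp add: b_def)
  have last_row: "(i, y) \<in> T \<longleftrightarrow> 1 \<le> i \<and> i \<le> b" for i
    using mem_iff_row[OF T, of i y] by (simp add: b_def)
  then have "(b, y) \<in> T" using b1 by simp
  then have br: "b \<le> r" using tail[of b y] y pos by (cases "r < b") auto
  \<comment> \<open>Rows up to \<open>a\<close> have length \<open>Suc (r + e)\<close>, those from
    \<open>a + 1\<close> to \<open>P\<close> length \<open>r + e\<close>; hence the new cells split
    at \<open>c\<close> between two columns. They fit since
    \<open>b \<le> r \<le> P\<close>.\<close>
  define c where "c = min a b"
  have c: "1 \<le> c" "c \<le> a" "c \<le> b" "c = a \<or> c = b" using pos b1 by (auto simp: c_def)
  define A where "A = {1..b} \<times> {y}"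
  define B where "B = {Suc (Suc (r + e))} \<times> {1..c} \<union> {Suc (r + e)} \<times> {c<..b}"
  have B_disj: "{Suc (Suc (r + e))} \<times> {1..c} \<inter> {Suc (r + e)} \<times> {c<..b} = {}" by auto
  have TA: "(i, j) \<in> T - A \<longleftrightarrow> (i, j) \<in> T \<and> j < y" for i j
    using last_row mem_box[of i j] unfolding A_def y_def by (cases "j = tab_width T") auto
  have memS: "(i, j) \<in> T - A \<union> B \<longleftrightarrow> (i, j) \<in> T \<and> j < y \<or>
      i = Suc (Suc (r + e)) \<and> 1 \<le> j \<and> j \<le> c \<or> i = Suc (r + e) \<and> c < j \<and> j \<le> b" for i j
    unfolding Un_iff TA B_def by auto
  show ?thesis
  proof (rule exchange_improves[OF T])
    show "A \<subseteq> T" by (auto simp: A_def last_row)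
    show "B \<inter> (T - A) = {}" 
      using c pos tail[of "Suc (r + e)"] tail[of "Suc (Suc (r + e))"] by (auto simp: B_def)
    show "finite B" by (simp add: B_def)
    show "card A = card B"
      unfolding B_def using c
      by (subst card_Un_disjoint[OF _ _ B_disj]) (auto simp: card_cartesian_product A_def)
    show "T - A \<union> B \<subseteq> {1..Suc (Suc (r + e))} \<times> {1..y - 1}"
    proof (rule subrelI)
      fix i j assume "(i, j) \<in> T - A \<union> B"
      then show "(i, j) \<in> {1..Suc (Suc (r + e))} \<times> {1..y - 1}"
        using mem_box[of i j] y c br assms(1) unfolding memS by auto
    qed
    show "Suc (Suc (r + e)) + (y - 1) \<le> tab_length T + tab_width T"
      using y by (simp add: length_eq y_def)
    show "young_tableau (T - A \<union> B)"
    proof (rule young_tableauI)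
      show "finite (T - A \<union> B)" using young_finite[OF T] by (simp add: B_def)
      show "1 \<le> i \<and> 1 \<le> j" if "(i, j) \<in> T - A \<union> B" for i j
        using that young_pos[OF T, of i j] unfolding memS by auto
      show "(i', j') \<in> T - A \<union> B"
        if "(i, j) \<in> T - A \<union> B" "1 \<le> i'" "i' \<le> i" "1 \<le> j'" "j' \<le> j" for i j i' j'
      proof (cases "(i, j) \<in> T \<and> j < y")
        case True
        then show ?thesis
          using that young_down[OF T, of i j i' j'] unfolding memS by auto
      next
        case False
        then have j': "j' \<le> b" "j' \<le> P" "j' < y"
          and "i' \<le> r + e \<or> i' = Suc (r + e) \<and> (j' \<le> a \<or> c < j') \<or> i' = Suc (Suc (r + e)) \<and> j' \<le> c"
          using that c br y assms(1) unfolding memS by auto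
        then consider "i' \<le> r + e" | "i' = Suc (r + e)" "j' \<le> a" | "i' = Suc (r + e)" "c < j'"
          | "i' = Suc (Suc (r + e))" "j' \<le> c" by blast
        then show ?thesis
        proof cases
          case 1
          then show ?thesis unfolding memS using low_mem[of i' j'] j' that(2,4) by simp
        next
          case 2
          then show ?thesis unfolding memS using last_mem[of i' j'] j' that(2,4) by simp
        next
          case 3
          then show ?thesis unfolding memS using j' by simp
        next
          case 4
          then show ?thesis unfolding memS using that(4) by simp
        qed
      qed
    qed
    have len: "1 \<le> y" "y \<le> Suc (r + e)" using y assms(2) by (auto simp: y_def)
    have Z: "{1..b} = {1..c} \<union> {c<..b}" "{1..c} \<inter> {c<..b} = {}" using c by auto
    have "(\<Sum>(i, j)\<in>A. zlogz_step i + zlogz_step j)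
        = zlogz b + real c * zlogz_step y + real (b - c) * zlogz_step y"
      unfolding A_def using c
      by (simp only: sum_steps_rectangle sum_zlogz_step_from_1) (simp add: of_nat_diff algebra_simps)
    also have "\<dots> < zlogz b + real c * zlogz_step (Suc (Suc (r + e)))
        + real (b - c) * zlogz_step (Suc (r + e))"
      using c len
      by (intro add_less_le_mono add_strict_left_mono mult_strict_left_mono mult_left_mono
          zlogz_step_less zlogz_step_le) auto
    also have "\<dots> = (\<Sum>(i, j)\<in>B. zlogz_step i + zlogz_step j)"
      unfolding B_def
      by (subst sum.union_disjoint[OF _ _ B_disj])
        (simp_all only: sum_steps_rectangle sum_zlogz_step_from_1 sum_zlogz_step[OF c(3)], simp_all)
    finally show "(\<Sum>(i, j)\<in>A. zlogz_step i + zlogz_step j)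
        < (\<Sum>(i, j)\<in>B. zlogz_step i + zlogz_step j)" .
  qed
qed

end

lemma improvable_of_card_le:
  assumes T: "young_tableau T" and "T \<noteq> {}" and yx: "tab_width T \<le> tab_length T"
    and le: "card T \<le> (tab_length T - 1) * tab_width T"
  shows "improvable T"
proof -
  define x y where "x = tab_length T" and "y = tab_width T"
  have box: "T \<subseteq> {1..x} \<times> {1..y}" using young_subset_box[OF T] by (simp add: x_def y_def)
  then have xy: "1 \<le> x" "1 \<le> y" using \<open>T \<noteq> {}\<close> by auto
  have cardI: "card R \<le> card T" if "R \<subseteq> T" for R
    using card_mono[OF young_finite[OF T] that] .
  define a where "a = col_size T x"
  have "x \<in> {i. \<exists>j. (i, j) \<in> T}" using young_columns[OF T] xy by (simp add: x_def)
  then obtain j where "(x, j) \<in> T" by blast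
  then have a1: "1 \<le> a" using mem_iff_col[OF T, of x j] by (simp add: a_def)
  have last: "(x, j) \<in> T \<longleftrightarrow> 1 \<le> j \<and> j \<le> a" for j
    using mem_iff_col[OF T, of x j] by (simp add: a_def)
  have "1 < x"
  proof (rule ccontr)
    assume "\<not> 1 < x"
    then have "card T = 0" using le by (simp add: x_def)
    then show False using \<open>T \<noteq> {}\<close> young_finite[OF T] by simp
  qed
  define P where "P = col_size T (x - 1)"
  have prev: "(x - 1, j) \<in> T \<longleftrightarrow> 1 \<le> j \<and> j \<le> P" for j
    using mem_iff_col[OF T, of "x - 1" j] by (simp add: P_def)
  have aP: "a \<le> P"
    using young_down[OF T, of x a "x - 1" a] last prev a1 \<open>1 < x\<close> by auto
  \<comment> \<open>Otherwise the first \<open>x - 1\<close> columns are full and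
    \<open>(x, 1)\<close> exceeds the allowed number of cells.\<close>
  have Py: "P < y"
  proof (rule ccontr)
    assume "\<not> P < y"
    then have "(x - 1, y) \<in> T" using prev xy by auto
    then have "insert (x, 1) ({1..x - 1} \<times> {1..y}) \<subseteq> T"
      using young_down[OF T, of "x - 1" y] last a1 by auto
    from cardI[OF this] have "Suc ((x - 1) * y) \<le> card T"
      using \<open>1 < x\<close> by (subst (asm) card_insert_disjoint) (auto simp: card_cartesian_product)
    then show False using le by (simp add: x_def y_def)
  qed
  define r where "r = row_size T (Suc P)"
  have row: "(i, Suc P) \<in> T \<longleftrightarrow> 1 \<le> i \<and> i \<le> r" for i
    using mem_iff_row[OF T, of i "Suc P"] by (simp add: r_def)
  have "Suc P \<in> {j. \<exists>i. (i, j) \<in> T}" using young_rows[OF T] Py by (simp add: y_def)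
  then obtain i where "(i, Suc P) \<in> T" by blast
  then have r1: "1 \<le> r" using row[of i] by simp
  \<comment> \<open>Column \<open>x - 1\<close> has height \<open>P\<close>, so it misses row
    \<open>Suc P\<close>; this gives \<open>e \<ge> 1\<close>.\<close>
  have "r < x - 1"
    using row[of "x - 1"] prev[of "Suc P"] \<open>1 < x\<close> by auto
  define e where "e = x - 1 - r"
  have e: "1 \<le> e" "x = Suc (r + e)" using \<open>r < x - 1\<close> by (auto simp: e_def)
  interpret step_tail T r e a P
  proof
    show "(i, j) \<in> T" if "1 \<le> i" "i \<le> r" "1 \<le> j" "j \<le> Suc P" for i j
      using young_down[OF T, of r "Suc P" i j] row[of r] r1 that by simp
    show "(i, j) \<in> T \<longleftrightarrow> i \<le> r + e \<and> 1 \<le> j \<and> j \<le> P \<or> i = Suc (r + e) \<and> 1 \<le> j \<and> j \<le> a"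
      if "r < i" for i j
    proof (cases "i \<le> r + e")
      case True
      have "j \<le> P" if "(i, j) \<in> T"
        using young_down[OF T that, of i "Suc P"] row[of i] \<open>r < i\<close> by fastforce
      moreover have "(i, j) \<in> T" if "1 \<le> j" "j \<le> P"
        using young_down[OF T, of "x - 1" j i j] prev[of j] that True \<open>r < i\<close> e by auto
      ultimately show ?thesis using True young_pos[OF T, of i j] by auto
    next
      case False
      then show ?thesis using last[of j] box e(2) by (cases "i = x") auto
    qed
  qed (use T r1 e a1 aP in auto)
  consider "e \<le> P" | "P < e" "r \<le> P" | "P < e" "P < r" by linarith
  then show ?thesis
  proof cases
    case 1
    show ?thesis
    proof (rule improvable_short_tail[OF 1])
      show "P \<le> r + e" using Py yx e by (simp add: x_def y_def)
      \<comment> \<open>If \<open>P = r + e\<close>, then \<open>x = y = Suc P\<close>. Row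
        \<open>y\<close> lacks exactly \<open>e\<close> of the first \<open>x - 1\<close> cells and
        the last column adds \<open>a\<close>, so the bound on \<open>card T\<close> forces
        \<open>a \<le> e\<close>.\<close>
      show "P < r + e \<or> a \<le> e"
      proof (rule ccontr)
        assume "\<not> (P < r + e \<or> a \<le> e)"
        then have "Suc P = y" "e < a" "y = x"
          using Py yx e by (auto simp: x_def y_def)
        have disj: "{1..r} \<times> {y} \<inter> {1..r + e} \<times> {1..P} = {}"
          "({1..r} \<times> {y} \<union> {1..r + e} \<times> {1..P}) \<inter> {x} \<times> {1..a} = {}"
          using \<open>Suc P = y\<close> e(2) by auto
        have "{1..r} \<times> {y} \<union> {1..r + e} \<times> {1..P} \<union> {x} \<times> {1..a} \<subseteq> T"
          using row \<open>Suc P = y\<close> low_mem last by auto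
        from cardI[OF this] have "r + (r + e) * P + a \<le> card T"
          using card_Un_disjoint[OF _ _ disj(1)] card_Un_disjoint[OF _ _ disj(2)]
          by (simp add: card_cartesian_product)
        also have "\<dots> \<le> (r + e) * Suc P"
          using le e(2) \<open>Suc P = y\<close> by (simp add: x_def y_def)
        finally show False using \<open>e < a\<close> by simp
      qed
    qed
  next
    case 2
    then show ?thesis
      using yx e(2) by (intro improvable_by_last_row) (auto simp: x_def)
  next
    case 3
    then show ?thesis by (intro improvable_by_restacking) auto
  qed
qed

section \<open>Deducing both bounds from maximality\<close>

theorem theorem14:
  fixes m n x y :: nat and T :: "(nat \<times> nat) set"
  assumes "m > 0" and "n > 0"
    and "young_tableau T" and "card T = m"
    and "x = tab_length T" and "y = tab_width T" and "x + y \<le> n"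
    and "\<And>S. young_tableau S \<Longrightarrow> card S = m \<Longrightarrow> tab_length S + tab_width S \<le> n \<Longrightarrow> tab_h S \<le> tab_h T"
  shows "int x * int y - int (min x y) < int m \<and> m \<le> x * y"
proof
  have T: "young_tableau T" "T \<noteq> {}" using assms(1,3,4) by auto
  have "\<not> improvable T"
    using assms(4-8) unfolding improvable_def by (metis le_trans not_le)
  have "card T \<le> card ({1..x} \<times> {1..y})"
    using young_subset_box[OF T(1)] assms(5,6) by (intro card_mono) auto
  then show "m \<le> x * y" using assms(4) by (simp add: card_cartesian_product)
  with \<open>m > 0\<close> have xy: "1 \<le> x" "1 \<le> y" by (auto simp: Suc_le_eq intro!: gr0I)
  show "int x * int y - int (min x y) < int m"
  proof (cases "y \<le> x")
    case True
    then have "(x - 1) * y < m"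
      using improvable_of_card_le[OF T] \<open>\<not> improvable T\<close> assms(4-6) by fastforce
    then have "int ((x - 1) * y) < int m" by (simp only: of_nat_less_iff)
    then show ?thesis using True xy by (simp add: of_nat_diff algebra_simps)
  next
    case False
    \<comment> \<open>For \<open>x < y\<close>, transposing preserves \<open>h\<close> and the
      number of cells and exchanges length and width, which reduces to the previous case.\<close>
    let ?T = "prod.swap ` T"
    have "\<not> improvable ?T" using improvable_swap \<open>\<not> improvable T\<close> by blast
    then have "(y - 1) * x < m"
      using improvable_of_card_le[OF young_swap[OF T(1)]] False T(2) assms(4-6)
      by (fastforce simp: tab_swap)
    then have "int ((y - 1) * x) < int m" by (simp only: of_nat_less_iff)
    then show ?thesis using False xy by (simp add: of_nat_diff algebra_simps)
  qed
qed

end
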